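(* Let $\omega_i=Y_{i1}(0)$. Suppose that $P(\nu_i>c)\in(0,1)$ for some $c\in\mathbb{R}$ and that $\nu_i$ is independent of $(\alpha_i,\varepsilon_{i1},\varepsilon_{i2},\mu_i,\eta_{i1},\eta_{i2})$. Suppose further that either $P(E[\dot Y_{i2}(0)-\dot Y_{i1}(0)\mid\omega_i]>0)<1$ or $P(E[\dot Y_{i2}(0)-\dot Y_{i1}(0)\mid\omega_i]<0)<1$. Then parallel trends, $E[Y_{i2}(0)-Y_{i1}(0)\mid G_i=1]=E[Y_{i2}(0)-Y_{i1}(0)\mid G_i=0]$, holds for all $g\in\mathcal{G}_\omega$ such that $G_i=g(\omega_i,\nu_i)$ satisfies $P(G_i=1)\in(0,1)$ if and only if $E[\dot Y_{i2}(0)\mid Y_{i1}(0)]=\dot Y_{i1}(0)$ almost surely.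
   Context: Units are indexed by $i$ (i.i.d. across $i$; all statements are about a generic unit $i$) and periods by $t\in\{1,2\}$. The unobservables $\alpha_i,\varepsilon_{i1},\varepsilon_{i2}$ are finite-dimensional random vectors, $\mu_i,\eta_{i1},\eta_{i2}$ are additional random vectors, and $\nu_i$ is a scalar random variable. The untreated potential outcomes are real-valued and given by $Y_{it}(0)=\xi_t(\alpha_i,\varepsilon_{it})$, $t=1,2$, for arbitrary (measurable) functions $\xi_t$. All relevant moments are assumed to exist (in particular $E|Y_{it}(0)|<\infty$). Notation: $\dot Y_{it}(0)=Y_{it}(0)-E[Y_{it}(0)]$. Let $\mathcal{O}$ and $\mathcal{V}$ be the supports of $\omega_i$ and $\nu_i$; $\mathcal{G}_\omega$ is the class of all (measurable) functions $g:\mathcal{O}\times\mathcal{V}\to\{0,1\}$, called selection mechanisms, and the treatment-group indicator generated by $g$ is $G_i=g(\omega_i,\nu_i)$. The distribution of the unobservables is held fixed as $g$ varies. *)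

theory Defs
  imports "HOL-Probability.Probability"
begin

definition rv_support :: "'s measure \<Rightarrow> ('s \<Rightarrow> 'b::topological_space) \<Rightarrow> 'b set" where
  "rv_support M X = {x. \<forall>U. open U \<longrightarrow> x \<in> U \<longrightarrow> measure M {s \<in> space M. X s \<in> U} > 0}"

text \<open>
  Independence of two random variables as independence of the sigma-algebras they generate;
  \<open>prob_space.indep_var\<close> requires both variables to have the same type.
\<close>
definition indep_rv ::
    "'s measure \<Rightarrow> ('s \<Rightarrow> 'b::topological_space) \<Rightarrow> ('s \<Rightarrow> 'c::topological_space) \<Rightarrow> bool" where
  "indep_rv M X Z \<longleftrightarrow>
     prob_space.indep_set M (sets (vimage_algebra (space M) X borel))
                            (sets (vimage_algebra (space M) Z borel))"

text \<open>
  The class \<open>\<G>\<^sub>\<omega>\<close>: measurable functions from the product of the supports of \<open>\<omega>\<close> and \<open>\<nu>\<close>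
  to \<open>{0,1}\<close>. As usual for functions on a subset, they are extensional. Since the pair
  \<open>(\<omega>, \<nu>)\<close> may leave the product of the supports on a null set, this also makes
  \<open>g (\<omega>, \<nu>)\<close> constant there, so that the events \<open>G = 0\<close> and \<open>G = 1\<close> are measurable.
\<close>
definition selection_mechanisms ::
    "'s measure \<Rightarrow> ('s \<Rightarrow> 'w::topological_space) \<Rightarrow> ('s \<Rightarrow> real) \<Rightarrow> ('w \<times> real \<Rightarrow> nat) set" where
  "selection_mechanisms M \<omega> \<nu> =
     {g \<in> extensional (rv_support M \<omega> \<times> rv_support M \<nu>).
        g \<in> restrict_space borel (rv_support M \<omega> \<times> rv_support M \<nu>) \<rightarrow>\<^sub>M count_space {0, 1}}"

definition treatment_group ::
    "('w \<times> real \<Rightarrow> nat) \<Rightarrow> ('s \<Rightarrow> 'w) \<Rightarrow> ('s \<Rightarrow> real) \<Rightarrow> 's \<Rightarrow> nat" where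
  "treatment_group g \<omega> \<nu> = (\<lambda>s. g (\<omega> s, \<nu> s))"

definition demean :: "'s measure \<Rightarrow> ('s \<Rightarrow> real) \<Rightarrow> 's \<Rightarrow> real" where
  "demean M X = (\<lambda>s. X s - integral\<^sup>L M X)"

text \<open>\<open>E[X | W]\<close>, conditioning on the sigma-algebra generated by \<open>W\<close>.\<close>
definition cond_mean ::
    "'s measure \<Rightarrow> ('s \<Rightarrow> real) \<Rightarrow> ('s \<Rightarrow> 'w::topological_space) \<Rightarrow> 's \<Rightarrow> real" where
  "cond_mean M X W = real_cond_exp M (vimage_algebra (space M) W borel) X"

text \<open>\<open>E[X | A]\<close> for an event \<open>A\<close>; only meaningful if \<open>A\<close> has positive probability.\<close>
definition event_mean :: "'s measure \<Rightarrow> ('s \<Rightarrow> real) \<Rightarrow> 's set \<Rightarrow> real" where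
  "event_mean M X A = (LINT s:A|M. X s) / measure M A"

definition parallel_trends ::
    "'s measure \<Rightarrow> ('s \<Rightarrow> real) \<Rightarrow> ('s \<Rightarrow> real) \<Rightarrow> ('s \<Rightarrow> nat) \<Rightarrow> bool" where
  "parallel_trends M Y1 Y2 G \<longleftrightarrow>
     event_mean M (\<lambda>s. Y2 s - Y1 s) {s \<in> space M. G s = 1} =
     event_mean M (\<lambda>s. Y2 s - Y1 s) {s \<in> space M. G s = 0}"

end

theory Submission imports Defs begin

text \<open>
  Let \<open>D\<close> be the demeaned trend \<open>Y2 - Y1\<close> and \<open>h = E[D | Y1]\<close>. As \<open>E[D] = 0\<close>, parallel trends for
  \<open>g\<close> says \<open>E[D 1{G = 1}] = 0\<close>. If \<open>h = 0\<close>, independence of \<open>\<nu>\<close> gives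
  \<open>E[D 1{Y1 \<in> A} 1{\<nu> \<in> C}] = E[h 1{Y1 \<in> A}] P(\<nu> \<in> C) = 0\<close> on rectangles, hence on all Borel sets of the
  plane. Conversely, take \<open>G = 1{h > 0}\<close>: since \<open>E[h] = 0\<close> excludes \<open>P(h > 0) = 1\<close>, parallel trends
  yields \<open>E[h 1{h > 0}] = 0\<close>, so \<open>h \<le> 0\<close> and therefore \<open>h = 0\<close> almost surely.
\<close>

section \<open>Supports of random variables and selection mechanisms\<close>

lemma closed_rv_support: "closed (rv_support M X)"
proof -
  have "- rv_support M X = \<Union> {U. open U \<and> \<not> measure M {s \<in> space M. X s \<in> U} > 0}"
    unfolding rv_support_def by blast
  then have "open (- rv_support M X)"
    by auto
  then show ?thesis
    by (simp add: closed_def)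
qed

text \<open>The complement of the support is a union of open null sets, possibly uncountable. Second
  countability replaces it by the countably many null sets of a basis.\<close>

lemma (in finite_measure) AE_in_rv_support:
  fixes X :: "'a \<Rightarrow> 'b::second_countable_topology"
  assumes [measurable]: "X \<in> borel_measurable M"
  shows "AE s in M. X s \<in> rv_support M X"
proof -
  obtain \<B> :: "'b set set" where \<B>: "countable \<B>" "topological_basis \<B>"
    using ex_countable_basis by blast
  define \<N> where "\<N> = {b \<in> \<B>. measure M {s \<in> space M. X s \<in> b} = 0}"
  have "AE s in M. X s \<notin> b" if "b \<in> \<N>" for b
  proof -
    have "open b"
      using that \<B>(2) by (auto simp: \<N>_def topological_basis_open)
    then have [measurable]: "b \<in> sets borel"
      by simp
    have "{s \<in> space M. X s \<in> b} \<in> null_sets M"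
      using that by (auto simp: \<N>_def null_sets_def emeasure_eq_measure)
    from AE_not_in[OF this] show ?thesis
      by auto
  qed
  moreover have "countable \<N>"
    using \<B>(1) by (simp add: \<N>_def)
  ultimately have "AE s in M. \<forall>b\<in>\<N>. X s \<notin> b"
    by (simp add: AE_ball_countable)
  then show ?thesis
  proof (rule AE_mp, intro AE_I2 impI)
    fix s assume s: "\<forall>b\<in>\<N>. X s \<notin> b"
    show "X s \<in> rv_support M X"
      unfolding rv_support_def
    proof (intro CollectI allI impI)
      fix U assume U: "open U" "X s \<in> U"
      then obtain b where b: "b \<in> \<B>" "X s \<in> b" "b \<subseteq> U"
        using \<B>(2) by (meson topological_basisE)
      have [measurable]: "U \<in> sets borel"
        using U by simp
      \<comment> \<open>A basic set containing \<open>X s\<close> cannot belong to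
        \<open>\<N>\<close>, since \<open>s\<close> avoids every member of
        \<open>\<N>\<close>.\<close>
      have "measure M {s \<in> space M. X s \<in> b} \<noteq> 0"
        using s b by (auto simp: \<N>_def)
      moreover have "measure M {s \<in> space M. X s \<in> b} \<le> measure M {s \<in> space M. X s \<in> U}"
        using b by (intro finite_measure_mono) auto
      ultimately show "measure M {s \<in> space M. X s \<in> U} > 0"
        using measure_nonneg[of M "{s \<in> space M. X s \<in> b}"] by linarith
    qed
  qed
qed

text \<open>Measurability of \<open>g\<close> is only given relative to the product of the supports.
  That product is closed, hence Borel, and outside it \<open>g\<close> is constant by
  extensionality, so level sets are Borel in the full space.\<close>

lemma selection_mechanism_vimage_borel:
  fixes \<omega> :: "'s \<Rightarrow> 'w::second_countable_topology"
  assumes "g \<in> selection_mechanisms M \<omega> \<nu>"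
  shows "g -` {i} \<in> sets borel"
proof -
  define S where "S = rv_support M \<omega> \<times> rv_support M \<nu>"
  have S: "S \<in> sets borel"
    unfolding S_def by (intro borel_closed closed_Times closed_rv_support)
  have ext: "g \<in> extensional S" and g: "g \<in> restrict_space borel S \<rightarrow>\<^sub>M count_space {0, 1}"
    using assms by (auto simp: selection_mechanisms_def S_def)
  \<comment> \<open>The index \<open>i\<close> is an arbitrary natural number; the intersection with
    \<open>{0, 1}\<close> turns \<open>{i}\<close> into a measurable set of the target
    space.\<close>
  have "g -` ({i} \<inter> {0, 1}) \<inter> S \<in> sets (restrict_space borel S)"
    using measurable_sets[OF g, of "{i} \<inter> {0, 1}"] by (simp add: space_restrict_space)
  moreover have "g -` ({i} \<inter> {0, 1}) \<inter> S = g -` {i} \<inter> S"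
    using measurable_space[OF g] by (fastforce simp: space_restrict_space)
  ultimately have "g -` {i} \<inter> S \<in> sets borel"
    using S by (simp add: sets_restrict_space_iff)
  moreover have "g -` {i} - S \<in> sets borel"
  \<comment> \<open>Outside \<open>S\<close> the value of \<open>g\<close> is the unspecified number
    \<open>undefined\<close>, so the level set contains either all of the complement of
    \<open>S\<close> or nothing of it.\<close>
  proof (cases "undefined = i")
    case True
    then have "g -` {i} - S = UNIV - S"
      using ext by (auto simp: extensional_def)
    then show ?thesis
      using S by auto
  next
    case False
    then have "g -` {i} - S = {}"
      using extensional_arb[OF ext] by fastforce
    then show ?thesis
      by (simp only: sets.empty_sets)
  qed
  ultimately have "(g -` {i} \<inter> S) \<union> (g -` {i} - S) \<in> sets borel"
    by blast
  then show ?thesis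
    by (simp add: Int_Diff_Un)
qed

text \<open>Only almost sure: where \<omega> or \<nu> leaves its support, \<open>g\<close> returns
  \<open>undefined\<close>, which may be neither 0 nor 1.\<close>

lemma (in finite_measure) treatment_group_AE:
  fixes \<omega> :: "'a \<Rightarrow> 'w::second_countable_topology"
  assumes "g \<in> selection_mechanisms M \<omega> \<nu>" "\<omega> \<in> borel_measurable M" "\<nu> \<in> borel_measurable M"
  shows "AE s in M. treatment_group g \<omega> \<nu> s \<in> {0, 1}"
proof -
  have g: "g \<in> restrict_space borel (rv_support M \<omega> \<times> rv_support M \<nu>) \<rightarrow>\<^sub>M count_space {0, 1}"
    using assms(1) by (auto simp: selection_mechanisms_def)
  show ?thesis
    using AE_in_rv_support[OF assms(2)] AE_in_rv_support[OF assms(3)]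
  proof eventually_elim
    case (elim s)
    then show ?case
      using measurable_space[OF g, of "(\<omega> s, \<nu> s)"]
      by (simp add: treatment_group_def space_restrict_space)
  qed
qed

section \<open>Parallel trends as a vanishing integral over the treated\<close>

lemma (in prob_space) integral_demean:
  "integrable M X \<Longrightarrow> (LINT s|M. demean M X s) = 0"
  by (simp add: demean_def prob_space)

lemma (in prob_space) integrable_demean:
  "integrable M X \<Longrightarrow> integrable M (demean M X)"
  by (simp add: demean_def)

text \<open>Demeaning shifts the mean trend by the same constant on every event, so it cancels when
  two groups are compared.\<close>

lemma (in prob_space) event_mean_demean:
  fixes Y1 Y2 :: "'a \<Rightarrow> real"
  assumes [measurable]: "integrable M Y1" "integrable M Y2" "A \<in> events"
    and "prob A \<noteq> 0"
  shows "event_mean M (\<lambda>s. Y2 s - Y1 s) A =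
    (LINT s:A|M. demean M Y2 s - demean M Y1 s) / prob A + (expectation Y2 - expectation Y1)"
proof -
  let ?D = "\<lambda>s. demean M Y2 s - demean M Y1 s"
  let ?k = "expectation Y2 - expectation Y1"
  have "integrable M ?D"
    using assms(1,2) by (simp add: integrable_demean)
  then have int: "set_integrable M A ?D" "set_integrable M A (\<lambda>s. ?k)"
    using assms(3) unfolding set_integrable_def by (auto intro: integrable_mult_indicator simp del: real_scaleR_def)
  have "(LINT s:A|M. Y2 s - Y1 s) = (LINT s:A|M. ?D s + ?k)"
    by (simp add: demean_def)
  also have "\<dots> = (LINT s:A|M. ?D s) + (LINT s:A|M. ?k)"
    using int by (rule set_integral_add)
  also have "(LINT s:A|M. ?k) = ?k * prob A"
    using sets.sets_into_space[OF assms(3)]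
    by (simp add: set_lebesgue_integral_def Int_absorb2)
  finally show ?thesis
    using assms(4) by (simp add: event_mean_def add_divide_distrib)
qed

text \<open>The demeaned trend has mean zero and the two groups exhaust the space up to a null set,
  so its integrals over them are x and -x. With p the probability of treatment, x / p = -x / (1 - p)
  forces x = 0, because 1 / p + 1 / (1 - p) is positive.\<close>

lemma (in prob_space) parallel_trends_iff:
  fixes Y1 Y2 :: "'a \<Rightarrow> real" and G :: "'a \<Rightarrow> nat"
  assumes Y: "integrable M Y1" "integrable M Y2"
    and ev [measurable]: "{s \<in> space M. G s = 1} \<in> events" "{s \<in> space M. G s = 0} \<in> events"
    and AE01: "AE s in M. G s \<in> {0, 1}"
    and p: "prob {s \<in> space M. G s = 1} \<in> {0<..<1}"
  shows "parallel_trends M Y1 Y2 G \<longleftrightarrow>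
    (LINT s:{s \<in> space M. G s = 1}|M. demean M Y2 s - demean M Y1 s) = 0"
proof -
  let ?A = "{s \<in> space M. G s = 1}" and ?B = "{s \<in> space M. G s = 0}"
  let ?D = "\<lambda>s. demean M Y2 s - demean M Y1 s"
  have disj: "?A \<inter> ?B = {}"
    by auto
  have "prob ?A + prob ?B = prob (?A \<union> ?B)"
    by (rule finite_measure_Union[OF ev disj, symmetric])
  also have "\<dots> = 1"
    using AE01 by (intro prob_eq_1[THEN iffD2] sets.Un ev) auto
  finally have pB: "prob ?B = 1 - prob ?A"
    by simp
  have D: "integrable M ?D"
    using Y by (auto intro: integrable_demean)
  then have setD: "set_integrable M ?A ?D" "set_integrable M ?B ?D"
    unfolding set_integrable_def using ev by (auto intro: integrable_mult_indicator simp del: real_scaleR_def)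
  have "(LINT s:?A|M. ?D s) + (LINT s:?B|M. ?D s) = (LINT s:?A \<union> ?B|M. ?D s)"
    using set_integral_Un[OF disj setD] by simp
  also have "\<dots> = (LINT s|M. ?D s)"
    unfolding set_lebesgue_integral_def
  proof (rule integral_cong_AE)
    show "AE s in M. indicator (?A \<union> ?B) s *\<^sub>R ?D s = ?D s"
      using AE01 AE_space by eventually_elim (auto simp: indicator_def)
  qed (use D in measurable)
  also have "\<dots> = 0"
    using Y by (simp add: integral_demean integrable_demean)
  finally have B: "(LINT s:?B|M. ?D s) = - (LINT s:?A|M. ?D s)"
    by simp
  have "parallel_trends M Y1 Y2 G \<longleftrightarrow>
      (LINT s:?A|M. ?D s) / prob ?A = - (LINT s:?A|M. ?D s) / (1 - prob ?A)"
    unfolding parallel_trends_def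
    using p pB B event_mean_demean[OF Y ev(1)] event_mean_demean[OF Y ev(2)] by simp
  also have "\<dots> \<longleftrightarrow> (LINT s:?A|M. ?D s) = 0"
    using p by (auto simp: field_simps)
  finally show ?thesis .
qed

section \<open>Sufficiency: from rectangles to all mechanisms\<close>

text \<open>Dynkin class argument. As \<open>D\<close> is signed, it runs on set integrals instead
  of measures: rectangles are stable under intersection, complements work because the whole space is
  a rectangle, and disjoint unions by countable additivity of the integral.\<close>

lemma (in prob_space) set_integral_pair_eq_0:
  fixes D :: "'a \<Rightarrow> real"
  assumes D: "integrable M D"
    and [measurable]: "W \<in> M \<rightarrow>\<^sub>M S" "V \<in> M \<rightarrow>\<^sub>M T"
    and rect: "\<And>A C. A \<in> sets S \<Longrightarrow> C \<in> sets T \<Longrightarrow>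
      (LINT s:{s \<in> space M. W s \<in> A \<and> V s \<in> C}|M. D s) = 0"
    and "B \<in> sets (S \<Otimes>\<^sub>M T)"
  shows "(LINT s:{s \<in> space M. (W s, V s) \<in> B}|M. D s) = 0"
proof -
  have si: "set_integrable M {s \<in> space M. (W s, V s) \<in> A} D" if "A \<in> sets (S \<Otimes>\<^sub>M T)" for A
    unfolding set_integrable_def
  proof (rule integrable_mult_indicator[OF _ D])
    note [measurable] = that
    show "{s \<in> space M. (W s, V s) \<in> A} \<in> events"
      by measurable
  qed
  show ?thesis
    using Int_stable_pair_measure_generator pair_measure_closed assms(5)
    unfolding sets_pair_measure
  proof (induct rule: sigma_sets_induct_disjoint)
    case (basic A)
    then show ?case
      using rect by auto
  next
    case empty
    show ?case
      by (simp add: set_lebesgue_integral_def)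
  next
    case (compl A)
    let ?A = "{s \<in> space M. (W s, V s) \<in> A}"
    let ?C = "{s \<in> space M. (W s, V s) \<in> space S \<times> space T - A}"
    have A [measurable]: "A \<in> sets (S \<Otimes>\<^sub>M T)"
      using compl(1) by (simp add: sets_pair_measure)
    have C: "space S \<times> space T - A \<in> sets (S \<Otimes>\<^sub>M T)"
      by measurable
    \<comment> \<open>The two events together form the event of the full rectangle, on which the
      integral vanishes by \<open>rect\<close>.\<close>
    have "?A \<union> ?C = {s \<in> space M. W s \<in> space S \<and> V s \<in> space T}"
      using measurable_space[OF assms(2)] measurable_space[OF assms(3)] by auto
    then have "0 = (LINT s:?A \<union> ?C|M. D s)"
      using rect[of "space S" "space T"] by simp
    also have "\<dots> = (LINT s:?A|M. D s) + (LINT s:?C|M. D s)"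
      by (rule set_integral_Un[OF _ si[OF A] si[OF C]]) auto
    finally show ?case
      using compl(2) by simp
  next
    case (union A)
    let ?P = "\<lambda>i. {s \<in> space M. (W s, V s) \<in> A i}"
    have A [measurable]: "A i \<in> sets (S \<Otimes>\<^sub>M T)" for i
      using union(2) by (auto simp: sets_pair_measure)
    have eq: "{s \<in> space M. (W s, V s) \<in> (\<Union>i. A i)} = (\<Union>i. ?P i)"
      by auto
    have "(LINT s:(\<Union>i. ?P i)|M. D s) = (\<Sum>i. LINT s:?P i|M. D s)"
    proof (rule lebesgue_integral_countable_add)
      show "set_integrable M (\<Union>i. ?P i) D"
        using si[of "\<Union>i. A i"] A unfolding eq by blast
      show "?P i \<inter> ?P j = {}" if "i \<noteq> j" for i j
        using union(1) that by (auto simp: disjoint_family_on_def)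
    qed measurable
    then show ?case
      unfolding eq using union(3) by simp
  qed
qed

text \<open>The sigma-algebra generated by a function of \<open>X\<close> lies inside the one
  generated by \<open>X\<close>, and independence passes to subfamilies. The maps \<open>e\<close>
  and \<open>f\<close> bring \<open>V\<close> and \<open>U\<close> into a common type, which
  \<open>indep_var\<close> demands.\<close>

lemma (in prob_space) indep_rv_imp_indep_var:
  fixes V :: "'a \<Rightarrow> 'b::topological_space" and U :: "'a \<Rightarrow> 'c::topological_space"
  assumes "indep_rv M V U" "V \<in> borel_measurable M" "U \<in> borel_measurable M"
    and "e \<in> borel \<rightarrow>\<^sub>M S" "f \<in> borel \<rightarrow>\<^sub>M T"
  shows "indep_var S (\<lambda>s. e (V s)) T (\<lambda>s. f (U s))"
proof -
  have pull: "sigma_sets (space M) {(\<lambda>s. e (X s)) -` A \<inter> space M |A. A \<in> sets S}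
      \<subseteq> sets (vimage_algebra (space M) X borel)"
    if "e \<in> borel \<rightarrow>\<^sub>M S" for X :: "'a \<Rightarrow> 'x::topological_space" and e :: "'x \<Rightarrow> 'y" and S
  proof -
    have "(\<lambda>s. e (X s)) \<in> vimage_algebra (space M) X borel \<rightarrow>\<^sub>M S"
      using measurable_compose[OF measurable_vimage_algebra1 that, of X "space M"] by simp
    then have "{(\<lambda>s. e (X s)) -` A \<inter> space M |A. A \<in> sets S} \<subseteq> sets (vimage_algebra (space M) X borel)"
      by (auto dest: measurable_sets)
    then show ?thesis
      using sets.sigma_sets_subset[of _ "vimage_algebra (space M) X borel"] by simp
  qed
  have "indep_set (sets (vimage_algebra (space M) V borel)) (sets (vimage_algebra (space M) U borel))"
    using assms(1) by (simp add: indep_rv_def)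
  then have "indep_set (sigma_sets (space M) {(\<lambda>s. e (V s)) -` A \<inter> space M |A. A \<in> sets S})
      (sigma_sets (space M) {(\<lambda>s. f (U s)) -` A \<inter> space M |A. A \<in> sets T})"
    unfolding indep_sets2_eq using pull[OF assms(4), of V] pull[OF assms(5), of U] by blast
  then show ?thesis
    unfolding indep_var_eq
    using measurable_compose[OF assms(2,4)] measurable_compose[OF assms(3,5)] by blast
qed

text \<open>Both \<open>D\<close> and \<open>W\<close> are written as functions of one vector
  \<open>U\<close>, because \<open>V\<close> has to be independent of them jointly: independence
  from each separately would not factor the expectation of a product of all three.\<close>

lemma (in prob_space) set_integral_eq_0_if_cond_mean_eq_0:
  fixes D W V :: "'a \<Rightarrow> real" and U :: "'a \<Rightarrow> 'c::topological_space"
  assumes D: "integrable M D" and W [measurable]: "W \<in> borel_measurable M"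
    and V [measurable]: "V \<in> borel_measurable M"
    and U: "U \<in> borel_measurable M" and indep: "indep_rv M V U"
    and d: "d \<in> borel_measurable borel" "D = (\<lambda>s. d (U s))"
    and w: "w \<in> borel_measurable borel" "W = (\<lambda>s. w (U s))"
    and h: "AE s in M. cond_mean M D W s = 0"
    and B: "B \<in> sets borel"
  shows "(LINT s:{s \<in> space M. (W s, V s) \<in> B}|M. D s) = 0"
proof (rule set_integral_pair_eq_0[OF D W V])
  let ?F = "vimage_algebra (space M) W borel"
  have "subalgebra M ?F"
    using measurable_iff_sets[of W M borel] by (simp add: subalgebra_def)
  then interpret F: finite_measure_subalgebra M ?F
    by unfold_locales
  fix A C :: "real set"
  assume A [measurable]: "A \<in> sets borel" and C [measurable]: "C \<in> sets borel"
  let ?f = "\<lambda>x. indicator A (w x) * d x"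
  \<comment> \<open>\<open>?f (U s)\<close> is \<open>D s\<close> cut off to the event that
    \<open>W s\<close> lies in \<open>A\<close>, expressed through \<open>U\<close> alone.\<close>
  have "indep_var borel (\<lambda>s. indicator C (V s) :: real) borel (\<lambda>s. ?f (U s))"
    by (intro indep_rv_imp_indep_var[OF indep V U] borel_measurable_times d
        measurable_compose[OF w(1)] borel_measurable_indicator A C)
  moreover have "integrable M (\<lambda>s. indicator C (V s) :: real)"
    by (rule integrable_const_bound[where B = 1]) (auto simp: indicator_def)
  moreover have "integrable M (\<lambda>s. ?f (U s))"
    using integrable_mult_indicator[of "W -` A \<inter> space M" M D] D
    by (auto simp: d(2) w(2) indicator_def measurable_sets[OF W A, unfolded w(2)]
        cong: Bochner_Integration.integrable_cong)
  ultimately have "(LINT s|M. indicator C (V s) * ?f (U s)) =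
      (LINT s|M. indicator C (V s)) * (LINT s|M. ?f (U s))"
    by (rule indep_var_lebesgue_integral)
  moreover have "(LINT s|M. ?f (U s)) = (LINT s:W -` A \<inter> space M|M. D s)"
    unfolding set_lebesgue_integral_def
    by (rule Bochner_Integration.integral_cong) (auto simp: d(2) w(2) indicator_def)
  moreover have "\<dots> = (LINT s:W -` A \<inter> space M|M. cond_mean M D W s)"
    unfolding cond_mean_def
    by (rule F.real_cond_exp_intA[OF D in_vimage_algebra[OF A]])
  moreover have "\<dots> = 0"
    unfolding set_lebesgue_integral_def
    by (rule integral_eq_zero_AE) (use h in eventually_elim, simp)
  moreover have "(LINT s:{s \<in> space M. W s \<in> A \<and> V s \<in> C}|M. D s) =
      (LINT s|M. indicator C (V s) * ?f (U s))"
    unfolding set_lebesgue_integral_def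
    by (rule Bochner_Integration.integral_cong) (auto simp: d(2) w(2) indicator_def)
  ultimately show "(LINT s:{s \<in> space M. W s \<in> A \<and> V s \<in> C}|M. D s) = 0"
    by simp
qed (use B in \<open>simp add: borel_prod[symmetric]\<close>)

section \<open>Necessity: treating exactly where the conditional trend is positive\<close>

text \<open>The last hypothesis is conditional because parallel trends is only available for
  nondegenerate groups. When the event is degenerate, mean zero alone yields \<open>h\<close> \<le>
  0 almost surely.\<close>

lemma (in prob_space) AE_eq_0_if_set_integral_pos_eq_0:
  fixes h :: "'a \<Rightarrow> real"
  assumes h: "integrable M h" "expectation h = 0"
    and "prob {s \<in> space M. 0 < h s} \<in> {0<..<1} \<Longrightarrow> (LINT s:{s \<in> space M. 0 < h s}|M. h s) = 0"
  shows "AE s in M. h s = 0"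
proof -
  let ?A = "{s \<in> space M. 0 < h s}"
  have [measurable]: "h \<in> borel_measurable M"
    using h(1) by simp
  have int: "integrable M (\<lambda>s. indicator ?A s *\<^sub>R h s)"
    using h(1) by (intro integrable_mult_indicator) measurable
  have "AE s in M. h s \<le> 0"
  proof -
    consider "prob ?A = 0" | "prob ?A = 1" | "prob ?A \<in> {0<..<1}"
      using measure_nonneg[of M ?A] prob_le_1[of ?A] by (auto simp: less_le)
    then show ?thesis
    proof cases
      case 1
      then have "AE s in M. \<not> 0 < h s"
        by (subst (asm) prob_eq_0) auto
      then show ?thesis
        by eventually_elim simp
    next
      \<comment> \<open>This case is in fact impossible: a nonnegative \<open>h\<close> with mean
        zero vanishes almost surely. Only the consequence \<open>h\<close> \<le> 0 is
        extracted.\<close>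
      case 2
      then have pos: "AE s in M. 0 < h s"
        by (subst (asm) prob_eq_1) auto
      then have "AE s in M. 0 \<le> h s"
        by eventually_elim simp
      then have "AE s in M. h s = 0"
        using integral_nonneg_eq_0_iff_AE[OF h(1)] h(2) by blast
      then show ?thesis
        by eventually_elim simp
    next
      case 3
      then have "(LINT s|M. indicator ?A s *\<^sub>R h s) = 0"
        using assms(3) by (simp add: set_lebesgue_integral_def)
      then have "AE s in M. indicator ?A s *\<^sub>R h s = 0"
        using integral_nonneg_eq_0_iff_AE[OF int] by (auto simp: indicator_def)
      then show ?thesis
        by (rule AE_mp) (auto simp: indicator_def split: if_splits)
    qed
  qed
  \<comment> \<open>Now \<open>- h\<close> is nonnegative almost surely and has mean zero.\<close>
  then have "AE s in M. - h s = 0"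
    using integral_nonneg_eq_0_iff_AE[of M "\<lambda>s. - h s"] h by (simp del: neg_equal_0_iff_equal)
  then show ?thesis
    by simp
qed

text \<open>Supplies the witness for necessity: treatment decided by the first coordinate.
  \<open>restrict\<close> makes the function extensional.\<close>

lemma selection_mechanisms_indicator:
  fixes \<omega> :: "'s \<Rightarrow> 'w::second_countable_topology"
  assumes B: "B \<in> sets borel"
  shows "restrict (\<lambda>(w, v). if w \<in> B then 1 else 0) (rv_support M \<omega> \<times> rv_support M \<nu>)
    \<in> selection_mechanisms M \<omega> \<nu>"
proof -
  let ?S = "rv_support M \<omega> \<times> rv_support M \<nu>"
  have "fst \<in> restrict_space borel ?S \<rightarrow>\<^sub>M (borel :: 'w measure)"
    by (intro measurable_restrict_space1 borel_measurable_continuous_onI continuous_intros)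
  from measurable_sets[OF this B]
  have "{p \<in> space (restrict_space borel ?S). fst p \<in> B} \<in> sets (restrict_space borel ?S)"
    by (simp add: vimage_def Int_def conj_commute)
  then have "(\<lambda>p. if fst p \<in> B then 1 else 0 :: nat) \<in> restrict_space borel ?S \<rightarrow>\<^sub>M count_space {0, 1}"
    by (intro measurable_If measurable_const) auto
  moreover have "(\<lambda>p. if fst p \<in> B then 1 else 0 :: nat) \<in> restrict_space borel ?S \<rightarrow>\<^sub>M count_space {0, 1} \<longleftrightarrow>
     restrict (\<lambda>(w, v). if w \<in> B then 1 else 0 :: nat) ?S \<in> restrict_space borel ?S \<rightarrow>\<^sub>M count_space {0, 1}"
    by (rule measurable_cong) (auto simp: space_restrict_space)
  ultimately show ?thesis
    by (simp add: selection_mechanisms_def)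
qed

section \<open>The equivalence\<close>

theorem corollary3p7:
  fixes M :: "'s measure"
    and \<alpha> :: "'s \<Rightarrow> 'a::euclidean_space"
    and \<epsilon>1 :: "'s \<Rightarrow> 'e1::euclidean_space"
    and \<epsilon>2 :: "'s \<Rightarrow> 'e2::euclidean_space"
    and \<mu> :: "'s \<Rightarrow> 'm::euclidean_space"
    and \<eta>1 :: "'s \<Rightarrow> 'h1::euclidean_space"
    and \<eta>2 :: "'s \<Rightarrow> 'h2::euclidean_space"
    and \<nu> :: "'s \<Rightarrow> real"
    and \<xi>1 :: "'a \<times> 'e1 \<Rightarrow> real"
    and \<xi>2 :: "'a \<times> 'e2 \<Rightarrow> real"
    and Y1 Y2 \<omega> :: "'s \<Rightarrow> real"
    and c :: real
  assumes "prob_space M"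
    and "\<alpha> \<in> borel_measurable M" "\<epsilon>1 \<in> borel_measurable M" "\<epsilon>2 \<in> borel_measurable M"
    and "\<mu> \<in> borel_measurable M" "\<eta>1 \<in> borel_measurable M" "\<eta>2 \<in> borel_measurable M"
    and "\<nu> \<in> borel_measurable M"
    and "\<xi>1 \<in> borel_measurable borel" "\<xi>2 \<in> borel_measurable borel"
    and Y1: "Y1 = (\<lambda>s. \<xi>1 (\<alpha> s, \<epsilon>1 s))"
    and Y2: "Y2 = (\<lambda>s. \<xi>2 (\<alpha> s, \<epsilon>2 s))"
    and "integrable M Y1" "integrable M Y2"
    and \<omega>: "\<omega> = Y1"
    and "measure M {s \<in> space M. \<nu> s > c} \<in> {0<..<1}"
    and "indep_rv M \<nu> (\<lambda>s. (\<alpha> s, \<epsilon>1 s, \<epsilon>2 s, \<mu> s, \<eta>1 s, \<eta>2 s))"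
    and "measure M {s \<in> space M. cond_mean M (\<lambda>s. demean M Y2 s - demean M Y1 s) \<omega> s > 0} < 1
       \<or> measure M {s \<in> space M. cond_mean M (\<lambda>s. demean M Y2 s - demean M Y1 s) \<omega> s < 0} < 1"
  shows "(\<forall>g \<in> selection_mechanisms M \<omega> \<nu>.
            measure M {s \<in> space M. treatment_group g \<omega> \<nu> s = 1} \<in> {0<..<1} \<longrightarrow>
            parallel_trends M Y1 Y2 (treatment_group g \<omega> \<nu>))
     \<longleftrightarrow> (AE s in M. cond_mean M (demean M Y2) Y1 s = demean M Y1 s)"
proof -
  interpret prob_space M by fact
  define D where "D = (\<lambda>s. demean M Y2 s - demean M Y1 s)"
  define h where "h = cond_mean M D Y1"
  let ?F = "vimage_algebra (space M) Y1 borel"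
  let ?U = "\<lambda>s. (\<alpha> s, \<epsilon>1 s, \<epsilon>2 s, \<mu> s, \<eta>1 s, \<eta>2 s)"
  note Y = \<open>integrable M Y1\<close> \<open>integrable M Y2\<close>
  note dY = Y[THEN integrable_demean]
  have Y1m [measurable]: "Y1 \<in> borel_measurable M"
    using Y by simp
  have \<nu>m [measurable]: "\<nu> \<in> borel_measurable M"
    by fact
  have Dint: "integrable M D"
    unfolding D_def using dY by simp
  have D0: "expectation D = 0"
    unfolding D_def using dY Y by (simp add: integral_demean)
  have "subalgebra M ?F"
    using measurable_iff_sets[of Y1 M borel] by (simp add: subalgebra_def)
  then interpret F: finite_measure_subalgebra M ?F
    by unfold_locales
  have Y1F: "Y1 \<in> borel_measurable ?F"
    by (rule measurable_vimage_algebra1) simp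
  have hF: "h \<in> borel_measurable ?F"
    by (simp add: h_def cond_mean_def)
  have hint: "integrable M h" "expectation h = 0"
    using F.real_cond_exp_int[OF Dint] D0 by (auto simp: h_def cond_mean_def)

  \<comment> \<open>The demeaned \<open>Y1\<close> is measurable with respect to the sigma-algebra
    of \<open>Y1\<close>, so it is its own conditional mean, and the martingale condition becomes
    \<open>h\<close> = 0 almost surely.\<close>
  have "AE s in M. h s = cond_mean M (demean M Y2) Y1 s - cond_mean M (demean M Y1) Y1 s"
    unfolding h_def D_def cond_mean_def using dY by (intro F.real_cond_exp_diff)
  moreover have "AE s in M. cond_mean M (demean M Y1) Y1 s = demean M Y1 s"
    unfolding cond_mean_def
    using dY(1) Y1F by (intro F.real_cond_exp_F_meas) (auto simp: demean_def)
  ultimately have "AE s in M. h s = cond_mean M (demean M Y2) Y1 s - demean M Y1 s"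
    by eventually_elim simp
  then have rhs: "(AE s in M. cond_mean M (demean M Y2) Y1 s = demean M Y1 s) \<longleftrightarrow>
      (AE s in M. h s = 0)"
    by auto

  have ev: "{s \<in> space M. treatment_group g Y1 \<nu> s = i} \<in> events"
    if g: "g \<in> selection_mechanisms M Y1 \<nu>" for g i
  proof -
    have "(\<lambda>s. (Y1 s, \<nu> s)) \<in> borel_measurable M"
      by measurable
    from measurable_sets[OF this selection_mechanism_vimage_borel[OF g, of i]]
    show ?thesis
      by (simp add: treatment_group_def vimage_def Int_def conj_commute)
  qed
  have pt: "parallel_trends M Y1 Y2 (treatment_group g Y1 \<nu>) \<longleftrightarrow>
      (LINT s:{s \<in> space M. treatment_group g Y1 \<nu> s = 1}|M. D s) = 0"
    if "g \<in> selection_mechanisms M Y1 \<nu>"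
      "prob {s \<in> space M. treatment_group g Y1 \<nu> s = 1} \<in> {0<..<1}" for g
    unfolding D_def
    by (rule parallel_trends_iff[OF Y ev[OF that(1)] ev[OF that(1)]
          treatment_group_AE[OF that(1) Y1m \<nu>m] that(2)])

  show ?thesis
    unfolding \<omega> rhs
  proof (intro iffI ballI impI)
    assume all: "\<forall>g \<in> selection_mechanisms M Y1 \<nu>.
      prob {s \<in> space M. treatment_group g Y1 \<nu> s = 1} \<in> {0<..<1} \<longrightarrow>
      parallel_trends M Y1 Y2 (treatment_group g Y1 \<nu>)"
    let ?A = "{s \<in> space M. 0 < h s}"
    \<comment> \<open>As \<open>h\<close> is measurable for the sigma-algebra of \<open>Y1\<close>,
      positivity of \<open>h\<close> is the event that \<open>Y1\<close> lies in some Borel set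
      \<open>B\<close>. Hence a mechanism can select on it.\<close>
    have "?A \<in> sets ?F"
      using measurable_sets[OF hF, of "{0<..}"] by (simp add: vimage_def Int_def conj_commute)
    then obtain B where B: "B \<in> sets borel" "?A = Y1 -` B \<inter> space M"
      by (auto simp: sets_vimage_algebra2)
    define g :: "real \<times> real \<Rightarrow> nat" where
      "g = restrict (\<lambda>(w, v). if w \<in> B then 1 else 0) (rv_support M Y1 \<times> rv_support M \<nu>)"
    have g: "g \<in> selection_mechanisms M Y1 \<nu>"
      unfolding g_def by (rule selection_mechanisms_indicator[OF B(1)])
    let ?G = "{s \<in> space M. treatment_group g Y1 \<nu> s = 1}"
    have [measurable]: "?G \<in> events" "?A \<in> events"
      using ev[OF g] hint(1) by auto
    \<comment> \<open>Equality of the events can fail outside the supports, where \<open>g\<close>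
      is \<open>undefined\<close>.\<close>
    have AG: "AE s in M. s \<in> ?G \<longleftrightarrow> s \<in> ?A"
      using AE_in_rv_support[OF Y1m] AE_in_rv_support[OF \<nu>m] AE_space
    proof eventually_elim
      case (elim s)
      then have "s \<in> ?A \<longleftrightarrow> Y1 s \<in> B"
        using B(2) by auto
      then show ?case
        using elim by (simp add: treatment_group_def g_def)
    qed
    show "AE s in M. h s = 0"
    proof (rule AE_eq_0_if_set_integral_pos_eq_0[OF hint])
      assume "prob ?A \<in> {0<..<1}"
      moreover have "prob ?G = prob ?A"
        by (rule measure_eq_AE[OF AG]) measurable
      ultimately have "(LINT s:?G|M. D s) = 0"
        using all g pt[OF g] by auto
      moreover have "(LINT s:?G|M. D s) = (LINT s:?A|M. D s)"
        unfolding set_lebesgue_integral_def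
      proof (rule integral_cong_AE)
        show "AE s in M. indicator ?G s *\<^sub>R D s = indicator ?A s *\<^sub>R D s"
          using AG by eventually_elim (simp add: indicator_def)
      qed (use Dint in measurable)
      \<comment> \<open>Defining property of the conditional expectation on a set of
        \<open>?F\<close>.\<close>
      moreover have "(LINT s:?A|M. D s) = (LINT s:?A|M. h s)"
        using F.real_cond_exp_intA[OF Dint \<open>?A \<in> sets ?F\<close>] by (simp add: h_def cond_mean_def)
      ultimately show "(LINT s:?A|M. h s) = 0"
        by simp
    qed
  next
    fix g
    assume h0: "AE s in M. h s = 0" and g: "g \<in> selection_mechanisms M Y1 \<nu>"
      and p: "prob {s \<in> space M. treatment_group g Y1 \<nu> s = 1} \<in> {0<..<1}"
    \<comment> \<open>\<open>w\<close> and \<open>d\<close> express \<open>Y1\<close> and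
      \<open>D\<close> through the whole vector \<open>?U\<close>. The type annotations fix the
      components that do not occur in the bodies.\<close>
    define w where "w = (\<lambda>(a, e1, e2 :: 'e2, m :: 'm, h1 :: 'h1, h2 :: 'h2). \<xi>1 (a, e1))"
    define d where "d = (\<lambda>(a, e1, e2, m :: 'm, h1 :: 'h1, h2 :: 'h2).
      \<xi>2 (a, e2) - expectation Y2 - (\<xi>1 (a, e1) - expectation Y1))"
    \<comment> \<open>The coordinate projections are continuous, so composing them with the Borel
      functions \<xi>1 and \<xi>2 stays Borel on the nested product type.\<close>
    have "(\<lambda>x. \<xi>1 (fst x, fst (snd x))) \<in> borel_measurable
        (borel :: ('a \<times> 'e1 \<times> 'e2 \<times> 'm \<times> 'h1 \<times> 'h2) measure)"
      by (rule measurable_compose[OF _ \<open>\<xi>1 \<in> borel_measurable borel\<close>])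
        (intro borel_measurable_continuous_onI continuous_intros)
    moreover have "(\<lambda>x. \<xi>2 (fst x, fst (snd (snd x)))) \<in> borel_measurable
        (borel :: ('a \<times> 'e1 \<times> 'e2 \<times> 'm \<times> 'h1 \<times> 'h2) measure)"
      by (rule measurable_compose[OF _ \<open>\<xi>2 \<in> borel_measurable borel\<close>])
        (intro borel_measurable_continuous_onI continuous_intros)
    ultimately have wd: "w \<in> borel_measurable borel" "d \<in> borel_measurable borel"
      unfolding w_def d_def by (auto simp: case_prod_unfold)
    have "?U \<in> borel_measurable M"
      using assms(2-7) by (intro borel_measurable_Pair)
    \<comment> \<open>The treated event is the preimage under \<open>Y1\<close> and \<nu> of a Borel
      set of the plane, namely the level set of \<open>g\<close> at 1.\<close>
    then have "(LINT s:{s \<in> space M. (Y1 s, \<nu> s) \<in> g -` {1}}|M. D s) = 0"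
      using wd h0 \<open>indep_rv M \<nu> ?U\<close> selection_mechanism_vimage_borel[OF g]
      by (intro set_integral_eq_0_if_cond_mean_eq_0[OF Dint Y1m \<nu>m, where U = ?U and d = d and w = w])
        (auto simp: w_def d_def D_def demean_def Y1 Y2 h_def)
    then show "parallel_trends M Y1 Y2 (treatment_group g Y1 \<nu>)"
      unfolding pt[OF g p] by (simp add: treatment_group_def)
  qed
qed

end
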